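(* Let $\Lambda$ be a net of quadrics in $\mathbb{P}^5$ (a point of $Gr(3,W)$). Suppose that $\Lambda$ is stable with respect to every one-parameter subgroup of each of the following numerical types: $\rho_1=(1,1,1,1,1,-5)$, $\rho_2=(1,1,1,1,-2,-2)$, $\rho_3=(1,1,1,-1,-1,-1)$, $\rho_4=(2,2,-1,-1,-1,-1)$, $\rho_5=(5,-1,-1,-1,-1,-1)$, $\rho_6=(2,2,2,-1,-1,-4)$, $\rho_7=(7,1,1,1,-5,-5)$, $\rho_8=(4,1,1,-2,-2,-2)$, $\rho_9=(3,1,1,-1,-1,-3)$, $\rho_{10}=(2,1,0,0,-1,-2)$, $\rho_{11}=(5,5,-1,-1,-1,-7)$, $\rho_{12}=(1,1,0,0,-1,-1)$, $\rho_{13}=(5,3,1,-1,-3,-5)$. Then $\Lambda$ is stable (with respect to the $SL(6)$-action).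
   Context: Let $V=H^0(\mathbb{P}^5,\mathcal{O}(1))$ and $W=H^0(\mathbb{P}^5,\mathcal{O}(2))$. A net of quadrics in $\mathbb{P}^5$ is a $3$-dimensional subspace $\Lambda\subset W$, viewed as a point of the Grassmannian $Gr(3,W)\subset\mathbb{P}(\bigwedge^3 W)$ (Plücker embedding), with the induced action of $SL(6)=SL(V)$. A one-parameter subgroup (1-PS) of numerical type $(a_0,\dots,a_5)$ (with $a_0\ge\cdots\ge a_5$, $\sum a_k=0$) is one acting diagonally on some basis $x_0,\dots,x_5$ of $V$ with weights $a_0,\dots,a_5$. Its weight on a quadratic monomial is $\omega(x_ix_j)=a_i+a_j$, and on a Plücker coordinate $x_{i_1}x_{j_1}\wedge x_{i_2}x_{j_2}\wedge x_{i_3}x_{j_3}$ it is the sum of the three monomial weights. $\Lambda$ is stable (resp. semistable) with respect to a 1-PS $\rho$ if some Plücker coordinate not vanishing on $\Lambda$ has positive (resp. nonnegative) $\rho$-weight; equivalently, for a basis $Q_1,Q_2,Q_3$ of $\Lambda$ there are monomials $m_1,m_2,m_3$ with nonzero coefficient in $Q_1\wedge Q_2\wedge Q_3$ and $\sum\omega_\rho(m_k)>0$ (resp. $\ge0$). $\Lambda$ is stable (resp. semistable) if it is so with respect to every 1-PS of $SL(6)$ (Hilbert–Mumford criterion). *)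

theory Defs
  imports Complex_Main
begin

text \<open>Quadratic forms on V = C^6 are represented by 6x6 symmetric matrices
 A (indices 0..5), Q(y) = y^T A y. A change of coordinates y = P x (P invertible)
 turns A into P^T A P.  The coefficient of the monomial x_i x_j (i \<le> j) is
 A i i if i = j and A i j + A j i otherwise.\<close>

type_synonym qmat = "nat \<Rightarrow> nat \<Rightarrow> complex"

definition congr6 :: "qmat \<Rightarrow> qmat \<Rightarrow> qmat" where
  "congr6 P A = (\<lambda>i j. \<Sum>k<6. \<Sum>l<6. P k i * A k l * P l j)"

definition invertible6 :: "qmat \<Rightarrow> bool" where
  "invertible6 P \<longleftrightarrow> (\<exists>R. \<forall>i<6. \<forall>j<6.
      (\<Sum>k<6. P i k * R k j) = (if i = j then 1 else 0))"

definition symmetric6 :: "qmat \<Rightarrow> bool" where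
  "symmetric6 A \<longleftrightarrow> (\<forall>i<6. \<forall>j<6. A i j = A j i)"

definition quad_monos :: "(nat \<times> nat) set" where
  "quad_monos = {(i, j). i \<le> j \<and> j < 6}"

definition qcoeff :: "qmat \<Rightarrow> nat \<times> nat \<Rightarrow> complex" where
  "qcoeff A m = (case m of (i, j) \<Rightarrow> if i = j then A i i else A i j + A j i)"

definition mweight :: "(nat \<Rightarrow> int) \<Rightarrow> nat \<times> nat \<Rightarrow> int" where
  "mweight a m = (case m of (i, j) \<Rightarrow> a i + a j)"

definition det3 :: "(nat \<Rightarrow> nat \<Rightarrow> complex) \<Rightarrow> complex" where
  "det3 M = M 0 0 * (M 1 1 * M 2 2 - M 1 2 * M 2 1)
          - M 0 1 * (M 1 0 * M 2 2 - M 1 2 * M 2 0)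
          + M 0 2 * (M 1 0 * M 2 1 - M 1 1 * M 2 0)"

definition plucker :: "qmat \<Rightarrow> qmat \<Rightarrow> qmat \<Rightarrow> nat \<times> nat \<Rightarrow> nat \<times> nat \<Rightarrow> nat \<times> nat \<Rightarrow> complex" where
  "plucker Q1 Q2 Q3 m1 m2 m3 =
     det3 (\<lambda>r c. qcoeff ([Q1, Q2, Q3] ! r) ([m1, m2, m3] ! c))"

definition is_net :: "qmat \<Rightarrow> qmat \<Rightarrow> qmat \<Rightarrow> bool" where
  "is_net Q1 Q2 Q3 \<longleftrightarrow> symmetric6 Q1 \<and> symmetric6 Q2 \<and> symmetric6 Q3 \<and>
     (\<forall>a b c. (\<forall>i<6. \<forall>j<6. a * Q1 i j + b * Q2 i j + c * Q3 i j = 0)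
        \<longrightarrow> a = 0 \<and> b = 0 \<and> c = 0)"

text \<open>Stability w.r.t. the 1-PS acting diagonally with weights a on the basis x
 given by coordinates y = P x.\<close>
definition stable_wrt :: "qmat \<Rightarrow> qmat \<Rightarrow> qmat \<Rightarrow> qmat \<Rightarrow> (nat \<Rightarrow> int) \<Rightarrow> bool" where
  "stable_wrt Q1 Q2 Q3 P a \<longleftrightarrow>
     (\<exists>m1\<in>quad_monos. \<exists>m2\<in>quad_monos. \<exists>m3\<in>quad_monos.
        plucker (congr6 P Q1) (congr6 P Q2) (congr6 P Q3) m1 m2 m3 \<noteq> 0 \<and>
        mweight a m1 + mweight a m2 + mweight a m3 > 0)"

definition numtype :: "(nat \<Rightarrow> int) \<Rightarrow> bool" where
  "numtype a \<longleftrightarrow> (\<forall>i<5. a (Suc i) \<le> a i) \<and> (\<Sum>i<6. a i) = 0 \<and> (\<exists>i<6. a i \<noteq> 0)"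

definition stable_type :: "qmat \<Rightarrow> qmat \<Rightarrow> qmat \<Rightarrow> int list \<Rightarrow> bool" where
  "stable_type Q1 Q2 Q3 w \<longleftrightarrow>
     (\<forall>P. invertible6 P \<longrightarrow> stable_wrt Q1 Q2 Q3 P (\<lambda>i. w ! i))"

definition net_stable :: "qmat \<Rightarrow> qmat \<Rightarrow> qmat \<Rightarrow> bool" where
  "net_stable Q1 Q2 Q3 \<longleftrightarrow>
     (\<forall>a P. numtype a \<and> invertible6 P \<longrightarrow> stable_wrt Q1 Q2 Q3 P a)"

end

theory Submission
  imports Defs
begin

text \<open>If a net is not stable for weights a in some basis, take a nonvanishing Pluecker coordinate
  of maximal a-weight and sort the a-weights of its three monomials as w1, w2, w3, so that
  w1 + w2 + w3 is at most 0. By exchange, every nonvanishing Pluecker coordinate has its monomials,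
  suitably ordered, of a-weight at most w1, w2, w3. Linear arithmetic shows that for one of the
  thirteen types these three bounds force nonpositive weight, with a single exception, the shape
  of a = (1,0,0,0,0,-1): there only x0 x5 and monomials without x0 occur. As the monomials of
  a nonvanishing coordinate are distinct, x0 x5 occurs in it at most once, which contradicts stability
  for (5,-1,-1,-1,-1,-1). No change of basis is needed.\<close>

section \<open>Exchange relations among Pluecker coordinates\<close>

lemma plucker_swap12:
  "plucker Q1 Q2 Q3 m2 m1 m3 = 0 \<longleftrightarrow> plucker Q1 Q2 Q3 m1 m2 m3 = 0"
  and plucker_swap23:
    "plucker Q1 Q2 Q3 m1 m3 m2 = 0 \<longleftrightarrow> plucker Q1 Q2 Q3 m1 m2 m3 = 0"
proof -
  have "plucker Q1 Q2 Q3 m2 m1 m3 = - plucker Q1 Q2 Q3 m1 m2 m3"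
    "plucker Q1 Q2 Q3 m1 m3 m2 = - plucker Q1 Q2 Q3 m1 m2 m3"
    by (simp_all add: plucker_def det3_def numeral_2_eq_2 algebra_simps)
  then show "plucker Q1 Q2 Q3 m2 m1 m3 = 0 \<longleftrightarrow> plucker Q1 Q2 Q3 m1 m2 m3 = 0"
    "plucker Q1 Q2 Q3 m1 m3 m2 = 0 \<longleftrightarrow> plucker Q1 Q2 Q3 m1 m2 m3 = 0"
    by simp_all
qed

lemma plucker_distinct:
  assumes "plucker Q1 Q2 Q3 m1 m2 m3 \<noteq> 0"
  shows "m1 \<noteq> m2" "m2 \<noteq> m3" "m1 \<noteq> m3"
  using assms by (auto simp: plucker_def det3_def numeral_2_eq_2 algebra_simps)

lemma det3_mult:
  "det3 (\<lambda>r c. F r 0 * G 0 c + F r 1 * G 1 c + F r 2 * G 2 c) = det3 F * det3 G"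
  unfolding det3_def by algebra

text \<open>The 4x4 coefficient matrix with rows \<open>Q1\<close>, \<open>Q2\<close>,
  \<open>Q3\<close>, \<open>Q\<close> and columns \<open>b1\<close>, \<open>b2\<close>,
  \<open>b3\<close>, \<open>m\<close> has a repeated row, so its determinant vanishes. Expanding it
  along the last row gives this form of Cramer's rule.\<close>

lemma plucker_cramer:
  assumes "Q \<in> {Q1, Q2, Q3}"
  shows "plucker Q1 Q2 Q3 b1 b2 b3 * qcoeff Q m =
    qcoeff Q b1 * plucker Q1 Q2 Q3 m b2 b3 + qcoeff Q b2 * plucker Q1 Q2 Q3 b1 m b3
    + qcoeff Q b3 * plucker Q1 Q2 Q3 b1 b2 m"
  using assms by (auto simp: plucker_def det3_def numeral_2_eq_2 algebra_simps)

text \<open>The single replacements of a \<open>b\<close> by an \<open>n\<close> form a 3x3 matrix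
  of coordinates. Its determinant is nonzero by Cramer's rule, so some Leibniz term is nonzero, and
  that term pairs the \<open>b\<close>s with the \<open>n\<close>s. The identity for all
  \<open>\<phi>\<close> records that the \<open>k\<close>s rearrange the \<open>n\<close>s, in the
  form in which weights are transferred later.\<close>

lemma plucker_exchange:
  fixes Q1 Q2 Q3 :: qmat
  defines "p \<equiv> plucker Q1 Q2 Q3"
  assumes b: "p b1 b2 b3 \<noteq> 0" and n: "p n1 n2 n3 \<noteq> 0"
  obtains k1 k2 k3 where "{k1, k2, k3} = {n1, n2, n3}" "p k1 k2 k3 \<noteq> 0"
    "p k1 b2 b3 \<noteq> 0" "p b1 k2 b3 \<noteq> 0" "p b1 b2 k3 \<noteq> 0"
    "\<And>\<phi>::nat \<times> nat \<Rightarrow> int. \<phi> k1 + \<phi> k2 + \<phi> k3 = \<phi> n1 + \<phi> n2 + \<phi> n3"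
proof -
  define F where "F = (\<lambda>r c. qcoeff ([Q1, Q2, Q3] ! r) ([b1, b2, b3] ! c))"
  \<comment> \<open>Row r, column c holds the coordinate in which the r-th \<open>b\<close> is
    replaced by the c-th \<open>n\<close>. By Cramer's rule the matrix product of \<open>F\<close>
    and \<open>G\<close> is the coefficient matrix of the \<open>n\<close>s scaled by
    \<open>p b1 b2 b3\<close>.\<close>
  define G where
    "G = (\<lambda>r c. let m = [n1, n2, n3] ! c in [p m b2 b3, p b1 m b3, p b1 b2 m] ! r)"
  have "det3 (\<lambda>r c. p b1 b2 b3 * qcoeff ([Q1, Q2, Q3] ! r) ([n1, n2, n3] ! c))
      = det3 (\<lambda>r c. F r 0 * G 0 c + F r 1 * G 1 c + F r 2 * G 2 c)"
    unfolding det3_def F_def G_def p_def Let_def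
    by (simp add: plucker_cramer numeral_2_eq_2)
  moreover have "det3 (\<lambda>r c. p b1 b2 b3 * qcoeff ([Q1, Q2, Q3] ! r) ([n1, n2, n3] ! c))
      = p b1 b2 b3 ^ 3 * p n1 n2 n3"
    unfolding p_def plucker_def[of _ _ _ n1 n2 n3] det3_def
    by (simp add: algebra_simps power3_eq_cube)
  ultimately have "det3 F * det3 G \<noteq> 0"
    using b n unfolding det3_mult by (metis mult_eq_0_iff power_not_zero)
  then have "det3 G \<noteq> 0" by (metis mult_zero_right)
  moreover have
    "det3 G = p n1 b2 b3 * p b1 n2 b3 * p b1 b2 n3 - p n1 b2 b3 * p b1 n3 b3 * p b1 b2 n2
      - p n2 b2 b3 * p b1 n1 b3 * p b1 b2 n3 + p n2 b2 b3 * p b1 n3 b3 * p b1 b2 n1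
      + p n3 b2 b3 * p b1 n1 b3 * p b1 b2 n2 - p n3 b2 b3 * p b1 n2 b3 * p b1 b2 n1"
    by (simp add: det3_def G_def numeral_2_eq_2 algebra_simps)
  moreover have "x1 \<noteq> 0 \<or> x2 \<noteq> 0 \<or> x3 \<noteq> 0 \<or> x4 \<noteq> 0
    \<or> x5 \<noteq> 0 \<or> x6 \<noteq> 0"
    if "x1 - x2 - x3 + x4 + x5 - x6 \<noteq> 0" for x1 x2 x3 x4 x5 x6 :: complex
    using that by auto
  \<comment> \<open>One case for each permutation, that is, for each Leibniz term of
    \<open>det3 G\<close>.\<close>
  ultimately consider
      "p n1 b2 b3 * p b1 n2 b3 * p b1 b2 n3 \<noteq> 0"
    | "p n1 b2 b3 * p b1 n3 b3 * p b1 b2 n2 \<noteq> 0"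
    | "p n2 b2 b3 * p b1 n1 b3 * p b1 b2 n3 \<noteq> 0"
    | "p n2 b2 b3 * p b1 n3 b3 * p b1 b2 n1 \<noteq> 0"
    | "p n3 b2 b3 * p b1 n1 b3 * p b1 b2 n2 \<noteq> 0"
    | "p n3 b2 b3 * p b1 n2 b3 * p b1 b2 n1 \<noteq> 0"
    by metis
  then show ?thesis
  proof cases
    case 1
    then show ?thesis
      using n by (intro that[of n1 n2 n3]) (auto simp: p_def plucker_swap12 plucker_swap23)
  next
    case 2
    then show ?thesis
      using n by (intro that[of n1 n3 n2]) (auto simp: p_def plucker_swap12 plucker_swap23)
  next
    case 3
    then show ?thesis
      using n by (intro that[of n2 n1 n3]) (auto simp: p_def plucker_swap12 plucker_swap23)
  next
    case 4
    then show ?thesis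
      using n by (intro that[of n2 n3 n1]) (auto simp: p_def plucker_swap12 plucker_swap23)
  next
    case 5
    then show ?thesis
      using n by (intro that[of n3 n1 n2]) (auto simp: p_def plucker_swap12 plucker_swap23)
  next
    case 6
    then show ?thesis
      using n by (intro that[of n3 n2 n1]) (auto simp: p_def plucker_swap12 plucker_swap23)
  qed
qed

section \<open>A nonvanishing coordinate of maximal weight\<close>

lemma finite_quad_monos: "finite quad_monos"
  by (rule finite_subset[of _ "{..<6} \<times> {..<6}"]) (auto simp: quad_monos_def)

text \<open>Nonvanishing triples behave like bases of a matroid: one of maximal total weight
  dominates every other entry by entry, since an exchange that raised a single weight would raise
  the total. The identity for all \<open>\<phi>\<close> carries a second weight from the
  \<open>n\<close>s to the \<open>k\<close>s.\<close>

lemma greedy_plucker: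
  fixes Q1 Q2 Q3 :: qmat and \<omega> :: "nat \<times> nat \<Rightarrow> int"
  defines "p \<equiv> plucker Q1 Q2 Q3"
  assumes "c1 \<in> quad_monos" "c2 \<in> quad_monos" "c3 \<in> quad_monos" "p c1 c2 c3 \<noteq> 0"
  obtains b1 b2 b3 where "b1 \<in> quad_monos" "b2 \<in> quad_monos" "b3 \<in> quad_monos"
    "p b1 b2 b3 \<noteq> 0"
    "\<omega> b1 \<le> \<omega> b2" "\<omega> b2 \<le> \<omega> b3"
    "\<And>n1 n2 n3. \<lbrakk>n1 \<in> quad_monos; n2 \<in> quad_monos; n3 \<in> quad_monos; p n1 n2 n3 \<noteq> 0\<rbrakk> \<Longrightarrow>
      \<exists>k1\<in>quad_monos. \<exists>k2\<in>quad_monos. \<exists>k3\<in>quad_monos. p k1 k2 k3 \<noteq> 0 \<and>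
        \<omega> k1 \<le> \<omega> b1 \<and> \<omega> k2 \<le> \<omega> b2
          \<and> \<omega> k3 \<le> \<omega> b3 \<and>
        (\<forall>\<phi>::nat \<times> nat \<Rightarrow> int. \<phi> k1 + \<phi> k2 + \<phi> k3 = \<phi> n1 + \<phi> n2 + \<phi> n3)"
proof -
  define S where
    "S = {(m1, m2, m3) \<in> quad_monos \<times> quad_monos \<times> quad_monos. p m1 m2 m3 \<noteq> 0}"
  define tot where "tot = (\<lambda>(m1, m2, m3). \<omega> m1 + \<omega> m2 + \<omega> m3)"
  have fin: "finite (tot ` S)"
    unfolding S_def by (intro finite_imageI finite_subset[OF _ finite_cartesian_product[OF
          finite_quad_monos finite_cartesian_product[OF finite_quad_monos finite_quad_monos]]]) auto
  have "(c1, c2, c3) \<in> S" using assms by (simp add: S_def)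
  then have "Max (tot ` S) \<in> tot ` S" using fin by (intro Max_in) auto
  then obtain d1 d2 d3 where d: "(d1, d2, d3) \<in> S" "tot (d1, d2, d3) = Max (tot ` S)" by force
  \<comment> \<open>The set of maximizers is closed under permuting the three entries, so it
    contains a triple sorted by weight.\<close>
  define T where "T = {m \<in> S. tot m = Max (tot ` S)}"
  have swap: "(m2, m1, m3) \<in> T" "(m1, m3, m2) \<in> T" if "(m1, m2, m3) \<in> T" for m1 m2 m3
    using that plucker_swap12[of Q1 Q2 Q3 m2 m1 m3] plucker_swap23[of Q1 Q2 Q3 m1 m3 m2]
    by (auto simp: T_def S_def tot_def p_def add_ac)
  have "(d1, d2, d3) \<in> T" using d by (simp add: T_def)
  then have perms: "(d1, d2, d3) \<in> T" "(d1, d3, d2) \<in> T" "(d2, d1, d3) \<in> T"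
    "(d2, d3, d1) \<in> T" "(d3, d1, d2) \<in> T" "(d3, d2, d1) \<in> T"
    using swap by blast+
  have "\<exists>b1 b2 b3. (b1, b2, b3) \<in> T \<and> \<omega> b1 \<le> \<omega> b2
    \<and> \<omega> b2 \<le> \<omega> b3"
    using perms by (metis linear)
  then obtain b1 b2 b3 where b: "(b1, b2, b3) \<in> S" "\<omega> b1 \<le> \<omega> b2"
    "\<omega> b2 \<le> \<omega> b3"
    and bmax: "tot (b1, b2, b3) = Max (tot ` S)" by (auto simp: T_def)
  have max: "tot m \<le> tot (b1, b2, b3)" if "m \<in> S" for m
    unfolding bmax using fin that by simp
  show thesis
  proof (rule that[of b1 b2 b3])
    fix n1 n2 n3
    assume n: "n1 \<in> quad_monos" "n2 \<in> quad_monos" "n3 \<in> quad_monos"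
      "p n1 n2 n3 \<noteq> 0"
    have "plucker Q1 Q2 Q3 b1 b2 b3 \<noteq> 0" using b by (simp add: S_def p_def)
    then obtain k1 k2 k3 where k: "{k1, k2, k3} = {n1, n2, n3}" "p k1 k2 k3 \<noteq> 0"
      "p k1 b2 b3 \<noteq> 0" "p b1 k2 b3 \<noteq> 0" "p b1 b2 k3 \<noteq> 0"
      "\<And>\<phi>::nat \<times> nat \<Rightarrow> int. \<phi> k1 + \<phi> k2 + \<phi> k3 = \<phi> n1 + \<phi> n2 + \<phi> n3"
      using n(4) plucker_exchange unfolding p_def by metis
    have "{k1, k2, k3} \<subseteq> quad_monos"
      unfolding k(1) using n by simp
    then have km: "k1 \<in> quad_monos" "k2 \<in> quad_monos" "k3 \<in> quad_monos" by simp_all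
    \<comment> \<open>Each triple shares two entries with the maximizer, so comparing totals
      compares the remaining weights.\<close>
    have "(k1, b2, b3) \<in> S" "(b1, k2, b3) \<in> S" "(b1, b2, k3) \<in> S"
      using b(1) k km by (auto simp: S_def)
    from this[THEN max] have "\<omega> k1 \<le> \<omega> b1" "\<omega> k2 \<le> \<omega> b2"
      "\<omega> k3 \<le> \<omega> b3"
      by (simp_all add: tot_def)
    then show
      "\<exists>k1\<in>quad_monos. \<exists>k2\<in>quad_monos. \<exists>k3\<in>quad_monos. p k1 k2 k3 \<noteq> 0 \<and>
        \<omega> k1 \<le> \<omega> b1 \<and> \<omega> k2 \<le> \<omega> b2
          \<and> \<omega> k3 \<le> \<omega> b3 \<and>
        (\<forall>\<phi>::nat \<times> nat \<Rightarrow> int. \<phi> k1 + \<phi> k2 + \<phi> k3 = \<phi> n1 + \<phi> n2 + \<phi> n3)"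
      using k km by blast
  qed (use b in \<open>auto simp: S_def\<close>)
qed

section \<open>Linear inequalities between the weights\<close>

lemma quad_monos_eq:
  "quad_monos = {(0,0), (0,1), (0,2), (0,3), (0,4), (0,5), (1,1), (1,2), (1,3), (1,4), (1,5),
    (2,2), (2,3), (2,4), (2,5), (3,3), (3,4), (3,5), (4,4), (4,5), (5,5)}"
proof (intro subset_antisym subsetI)
  fix m assume "m \<in> quad_monos"
  then obtain i j where m: "m = (i, j)" "i \<le> j" "j < 6" by (auto simp: quad_monos_def)
  have "j \<in> {0, 1, 2, 3, 4, 5}" using m(3) by auto
  moreover have "i \<in> {0, 1, 2, 3, 4, 5}" using m(2,3) by auto
  ultimately show
    "m \<in> {(0,0), (0,1), (0,2), (0,3), (0,4), (0,5), (1,1), (1,2), (1,3), (1,4), (1,5),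
    (2,2), (2,3), (2,4), (2,5), (3,3), (3,4), (3,5), (4,4), (4,5), (5,5)}"
    using m(1,2) by (elim insertE emptyE) simp_all
qed (auto simp: quad_monos_def)

text \<open>All maximal ways, up to redundancy, to bound the monomial weights of each type by a
  nondecreasing triple with sum at most 0.\<close>

definition critical_bounds :: "(int list \<times> int \<times> int \<times> int) set" where
  "critical_bounds = {
    ([1,1,1,1,1,-5], -4, 2, 2),
    ([1,1,1,1,-2,-2], -4, 2, 2),
    ([1,1,1,1,-2,-2], -1, -1, 2),
    ([1,1,1,-1,-1,-1], -2, 0, 2),
    ([1,1,1,-1,-1,-1], 0, 0, 0),
    ([2,2,-1,-1,-1,-1], -2, -2, 4),
    ([2,2,-1,-1,-1,-1], -2, 1, 1),
    ([5,-1,-1,-1,-1,-1], -2, -2, 4),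
    ([2,2,2,-1,-1,-4], -2, -2, 4),
    ([7,1,1,1,-5,-5], -4, 2, 2),
    ([4,1,1,-2,-2,-2], -4, 2, 2),
    ([3,1,1,-1,-1,-3], -2, 0, 2),
    ([2,1,0,0,-1,-2], -2, 0, 2),
    ([5,5,-1,-1,-1,-7], -2, -2, 4),
    ([1,1,0,0,-1,-1], 0, 0, 0),
    ([5,3,1,-1,-3,-5], -2, 0, 2)}"

text \<open>The conclusion is the exceptional case: only x0 x5 and monomials without x0 have weight
  at most w3.\<close>

lemma weight_cover:
  fixes a :: "nat \<Rightarrow> int" and w1 w2 w3 :: int
  assumes "numtype a" and w: "w1 \<le> w2" "w2 \<le> w3" "w1 + w2 + w3 \<le> 0"
    and noncrit:
      "\<And>\<rho> v1 v2 v3. (\<rho>, v1, v2, v3) \<in> critical_bounds \<Longrightarrow>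
      \<exists>m\<in>quad_monos. mweight a m \<le> w1 \<and> v1 < mweight ((!) \<rho>) m
        \<or> mweight a m \<le> w2 \<and> v2 < mweight ((!) \<rho>) m
          \<or> mweight a m \<le> w3 \<and> v3 < mweight ((!) \<rho>) m"
  shows "w3 < a 0 + a 4"
proof (rule ccontr)
  \<comment> \<open>All \<open>u\<close> and \<open>d\<close> inequalities below hold for a =
    (1,0,0,0,0,-1) with bounds (0,0,0); \<open>big\<close> is what rules this case out.\<close>
  assume big: "\<not> w3 < a 0 + a 4"
  have ord: "a 1 \<le> a 0" "a 2 \<le> a 1" "a 3 \<le> a 2" "a 4 \<le> a 3" "a 5 \<le> a 4"
    using \<open>numtype a\<close> by (auto simp: numtype_def numeral_eq_Suc)
  have sum0: "a 0 + a 1 + a 2 + a 3 + a 4 + a 5 = 0"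
    using \<open>numtype a\<close> by (simp add: numtype_def numeral_eq_Suc)
  \<comment> \<open>The other facts used at the end are weak and homogeneous, hence true when all
    weights and bounds are 0. Every final contradiction therefore rests on this strict
    inequality.\<close>
  have strict: "a 5 < a 0"
  proof (rule ccontr)
    assume "\<not> a 5 < a 0"
    then have "a 0 = 0" "a 1 = 0" "a 2 = 0" "a 3 = 0" "a 4 = 0" "a 5 = 0"
      using ord sum0 by linarith+
    then show False using \<open>numtype a\<close>
      by (auto simp: numtype_def numeral_eq_Suc less_Suc_eq)
  qed
  \<comment> \<open>Only monomials of type weight above \<open>v1\<close>, \<open>v2\<close> or
    \<open>v3\<close> can witness \<open>noncrit\<close>. By \<open>ord\<close> it suffices to keep
    the lightest ones for each bound; in \<open>u1\<close> to \<open>u7\<close> a single inequality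
    remains.\<close>
  have u1: "a 4 + a 4 \<le> w1"
    by (rule ccontr, insert noncrit[of "[1,1,1,1,1,-5]" "-4" "2" "2"] ord w)
      (simp add: critical_bounds_def quad_monos_eq mweight_def)
  have u2: "a 3 + a 5 \<le> w1"
    by (rule ccontr, insert noncrit[of "[1,1,1,1,-2,-2]" "-4" "2" "2"] ord w)
      (simp add: critical_bounds_def quad_monos_eq mweight_def)
  have u3: "a 3 + a 3 \<le> w2"
    by (rule ccontr, insert noncrit[of "[1,1,1,1,-2,-2]" "-1" "-1" "2"] ord w)
      (simp add: critical_bounds_def quad_monos_eq mweight_def)
  have u4: "a 2 + a 2 \<le> w3"
    by (rule ccontr, insert noncrit[of "[1,1,1,-1,-1,-1]" "0" "0" "0"] ord w)
      (simp add: critical_bounds_def quad_monos_eq mweight_def)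
  have u5: "a 1 + a 5 \<le> w2"
    by (rule ccontr, insert noncrit[of "[2,2,-1,-1,-1,-1]" "-2" "-2" "4"] ord w)
      (simp add: critical_bounds_def quad_monos_eq mweight_def)
  have u6: "a 2 + a 4 \<le> w2"
    by (rule ccontr, insert noncrit[of "[2,2,2,-1,-1,-4]" "-2" "-2" "4"] ord w)
      (simp add: critical_bounds_def quad_monos_eq mweight_def)
  have u7: "a 1 + a 3 \<le> w3"
    by (rule ccontr, insert noncrit[of "[1,1,0,0,-1,-1]" "0" "0" "0"] ord w)
      (simp add: critical_bounds_def quad_monos_eq mweight_def)
  note unit = u1 u2 u3 u4 u5 u6 u7
  \<comment> \<open>For the other nine triples several alternatives remain, from different bounds or
    from monomials that \<open>ord\<close> does not compare.\<close>
  have d1: "a 2 + a 5 \<le> w1 \<or> a 2 + a 2 \<le> w2"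
    by (rule ccontr, insert noncrit[of "[1,1,1,-1,-1,-1]" "-2" "0" "2"] ord w)
      (simp add: critical_bounds_def quad_monos_eq mweight_def)
  have d2: "a 1 + a 5 \<le> w1 \<or> a 1 + a 1 \<le> w3"
    by (rule ccontr, insert noncrit[of "[2,2,-1,-1,-1,-1]" "-2" "1" "1"] ord w)
      (simp add: critical_bounds_def quad_monos_eq mweight_def)
  have d3: "a 0 + a 5 \<le> w2 \<or> a 0 + a 0 \<le> w3"
    by (rule ccontr, insert noncrit[of "[5,-1,-1,-1,-1,-1]" "-2" "-2" "4"] ord w)
      (simp add: critical_bounds_def quad_monos_eq mweight_def)
  have d4: "a 0 + a 5 \<le> w1 \<or> a 3 + a 3 \<le> w1 \<or> a 0 + a 3 \<le> w3"
    by (rule ccontr, insert noncrit[of "[7,1,1,1,-5,-5]" "-4" "2" "2"] ord w)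
      (simp add: critical_bounds_def quad_monos_eq mweight_def)
  have d5: "a 2 + a 5 \<le> w1 \<or> a 0 + a 2 \<le> w3"
    by (rule ccontr, insert noncrit[of "[4,1,1,-2,-2,-2]" "-4" "2" "2"] ord w)
      (simp add: critical_bounds_def quad_monos_eq mweight_def)
  have d6: "a 0 + a 5 \<le> w1 \<or> a 2 + a 4 \<le> w1 \<or> a 0 + a 4 \<le> w2
    \<or> a 2 + a 2 \<le> w2
      \<or> a 0 + a 2 \<le> w3"
    by (rule ccontr, insert noncrit[of "[3,1,1,-1,-1,-3]" "-2" "0" "2"] ord w)
      (simp add: critical_bounds_def quad_monos_eq mweight_def)
  have d7: "a 1 + a 5 \<le> w1 \<or> a 3 + a 4 \<le> w1 \<or> a 0 + a 4 \<le> w2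
    \<or> a 1 + a 3 \<le> w2
      \<or> a 0 + a 1 \<le> w3"
    by (rule ccontr, insert noncrit[of "[2,1,0,0,-1,-2]" "-2" "0" "2"] ord w)
      (simp add: critical_bounds_def quad_monos_eq mweight_def)
  have d8: "a 1 + a 4 \<le> w2 \<or> a 1 + a 1 \<le> w3"
    by (rule ccontr, insert noncrit[of "[5,5,-1,-1,-1,-7]" "-2" "-2" "4"] ord w)
      (simp add: critical_bounds_def quad_monos_eq mweight_def)
  have d9: "a 0 + a 5 \<le> w1 \<or> a 1 + a 4 \<le> w1 \<or> a 2 + a 3 \<le> w1
    \<or> a 0 + a 4 \<le> w2
      \<or> a 1 + a 3 \<le> w2 \<or> a 2 + a 2 \<le> w2 \<or> a 0 + a 3 \<le> w3
        \<or> a 1 + a 2 \<le> w3"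
    by (rule ccontr, insert noncrit[of "[5,3,1,-1,-3,-5]" "-2" "0" "2"] ord w)
      (simp add: critical_bounds_def quad_monos_eq mweight_def)
  \<comment> \<open>The disjunctions are split only as far as a branch requires. At each leaf the
    remaining inequalities force \<open>a 0 \<le> a 5\<close>.\<close>
  from d3 show False
  proof (elim disjE)
    assume h1: "a 0 + a 5 \<le> w2"
    from d2 show False
    proof (elim disjE)
      assume h2: "a 1 + a 5 \<le> w1"
      from d5 show False
      proof (elim disjE)
        assume h3: "a 2 + a 5 \<le> w1"
        from d6 show False
        proof (elim disjE)
          assume h4: "a 0 + a 5 \<le> w1"
          from d8 show False by (elim disjE)
            (use sum0 w(3) strict big unit(1,3,4,6,7) h4 in linarith)+
        next
          assume h5: "a 2 + a 4 \<le> w1"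
          from d8 show False
          proof (elim disjE)
            assume h6: "a 1 + a 4 \<le> w2"
            from d4 show False
            proof (elim disjE)
              assume h7: "a 3 + a 3 \<le> w1"
              from d9 show False by (elim disjE)
                (use ord(5) sum0 w(3) strict big unit(1,3,4,6,7) h1 h2 h5 h6 h7 in linarith)+
            qed (use sum0 w(3) strict big unit(1,3,4,7) h1 h2 h5 h6 in linarith)+
          next
            assume h8: "a 1 + a 1 \<le> w3"
            from d4 show False by (elim disjE)
              (use sum0 w(3) strict big unit(1,3,4,6) h1 h5 h8 in linarith)+
          qed
        next
          assume h9: "a 0 + a 4 \<le> w2"
          from d4 show False by (elim disjE)
            (use ord(1,5) sum0 w(3) strict big unit(1,3,4,7) h2 h9 in linarith)+
        next
          assume h10: "a 2 + a 2 \<le> w2"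
          from d8 show False
          proof (elim disjE)
            assume h11: "a 1 + a 4 \<le> w2"
            from d4 show False by (elim disjE)
              (use sum0 w(3) strict big unit(1,3,4,7) h1 h2 h10 h11 in linarith)+
          next
            assume h12: "a 1 + a 1 \<le> w3"
            from d4 show False by (elim disjE)
              (use sum0 w(3) strict big unit(1,3,4,6) h1 h2 h3 h10 h12 in linarith)+
          qed
        next
          assume h13: "a 0 + a 2 \<le> w3"
          from d8 show False by (elim disjE) (use sum0 w(3) strict unit(1,3,6) h1 h2 h13
            in linarith)+
        qed
      next
        assume h14: "a 0 + a 2 \<le> w3"
        from d8 show False by (elim disjE) (use sum0 w(3) strict unit(1,3,6) h1 h2 h14 in linarith)+
      qed
    next
      assume h15: "a 1 + a 1 \<le> w3"
      from d5 show False
      proof (elim disjE)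
        assume h16: "a 2 + a 5 \<le> w1"
        from d4 show False
        proof (elim disjE)
          assume h17: "a 3 + a 3 \<le> w1"
          from d6 show False by (elim disjE)
            (use ord(5) sum0 w(3) strict big unit(1,3,4,6) h1 h15 h16 h17 in linarith)+
        next
          assume h18: "a 0 + a 3 \<le> w3"
          from d6 show False
          proof (elim disjE)
            assume h19: "a 2 + a 2 \<le> w2"
            from d7 show False by (elim disjE)
              (use sum0 w(3) strict unit(1,2,3,6) h1 h15 h16 h18 h19 in linarith)+
          next
            assume h20: "a 0 + a 2 \<le> w3"
            from d7 show False by (elim disjE)
              (use sum0 w(3) strict unit(1,2,3,6) h1 h15 h16 h20 in linarith)+
          qed (use sum0 w(3) strict big unit(1,3,4,6) h1 h15 h16 h18 in linarith)+
        qed (use sum0 w(3) strict big unit(1,3,4,6) h15 in linarith)+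
      next
        assume h21: "a 0 + a 2 \<le> w3"
        from d7 show False
        proof (elim disjE)
          assume h22: "a 3 + a 4 \<le> w1"
          from d1 show False by (elim disjE)
            (use sum0 w(3) strict unit(3,6) h1 h15 h21 h22 in linarith)+
        next
          assume h23: "a 0 + a 4 \<le> w2"
          from d1 show False by (elim disjE)
            (use sum0 w(3) strict unit(1,2,3,7) h15 h21 h23 in linarith)+
        next
          assume h24: "a 1 + a 3 \<le> w2"
          from d1 show False by (elim disjE)
            (use sum0 w(3) strict unit(1,2) h1 h15 h21 h24 in linarith)+
        next
          assume h25: "a 0 + a 1 \<le> w3"
          from d1 show False by (elim disjE) (use sum0 w(3) strict unit(1,2,3,6) h1 h25
            in linarith)+
        qed (use sum0 w(3) strict unit(1,3,6) h1 h15 h21 in linarith)+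
      qed
    qed
  next
    assume h26: "a 0 + a 0 \<le> w3"
    from d1 show False by (elim disjE) (use ord(1) sum0 w(3) strict unit(1,2,3,5,6) h26
      in linarith)+
  qed
qed

section \<open>Stability for an arbitrary one-parameter subgroup\<close>

theorem theorem2p1:
  assumes "is_net Q1 Q2 Q3"
    and "\<forall>w \<in> set [[1,1,1,1,1,-5], [1,1,1,1,-2,-2], [1,1,1,-1,-1,-1],
                    [2,2,-1,-1,-1,-1], [5,-1,-1,-1,-1,-1], [2,2,2,-1,-1,-4],
                    [7,1,1,1,-5,-5], [4,1,1,-2,-2,-2], [3,1,1,-1,-1,-3],
                    [2,1,0,0,-1,-2], [5,5,-1,-1,-1,-7], [1,1,0,0,-1,-1],
                    [5,3,1,-1,-3,-5]]. stable_type Q1 Q2 Q3 w"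
  shows "net_stable Q1 Q2 Q3"
  unfolding net_stable_def
proof (intro allI impI, elim conjE, rule ccontr)
  fix a P
  assume a: "numtype a" and P: "invertible6 P" and unstable: "\<not> stable_wrt Q1 Q2 Q3 P a"
  define p where "p = plucker (congr6 P Q1) (congr6 P Q2) (congr6 P Q3)"
  have stab:
    "\<exists>n1\<in>quad_monos. \<exists>n2\<in>quad_monos. \<exists>n3\<in>quad_monos. p n1 n2 n3 \<noteq> 0 \<and>
      0 < mweight ((!) \<rho>) n1 + mweight ((!) \<rho>) n2 + mweight ((!) \<rho>) n3"
    if "stable_type Q1 Q2 Q3 \<rho>" for \<rho>
    using that P unfolding stable_type_def stable_wrt_def p_def by blast
  \<comment> \<open>This supplies a nonvanishing coordinate to start the maximization; the same type
    settles the exceptional case.\<close>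
  have "stable_type Q1 Q2 Q3 [5,-1,-1,-1,-1,-1]" using assms(2) by simp
  from stab[OF this] obtain c1 c2 c3 where
    "c1 \<in> quad_monos" "c2 \<in> quad_monos" "c3 \<in> quad_monos" "p c1 c2 c3 \<noteq> 0"
      by blast
  then obtain b1 b2 b3 where b: "b1 \<in> quad_monos" "b2 \<in> quad_monos" "b3 \<in> quad_monos"
    "p b1 b2 b3 \<noteq> 0"
    and le: "mweight a b1 \<le> mweight a b2" "mweight a b2 \<le> mweight a b3"
    and dominated:
      "\<And>n1 n2 n3. \<lbrakk>n1 \<in> quad_monos; n2 \<in> quad_monos; n3 \<in> quad_monos; p n1 n2 n3 \<noteq> 0\<rbrakk> \<Longrightarrow>
      \<exists>k1\<in>quad_monos. \<exists>k2\<in>quad_monos. \<exists>k3\<in>quad_monos. p k1 k2 k3 \<noteq> 0 \<and>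
        mweight a k1 \<le> mweight a b1 \<and> mweight a k2 \<le> mweight a b2
          \<and> mweight a k3 \<le> mweight a b3 \<and>
        (\<forall>\<phi>::nat \<times> nat \<Rightarrow> int. \<phi> k1 + \<phi> k2 + \<phi> k3 = \<phi> n1 + \<phi> n2 + \<phi> n3)"
    unfolding p_def by (rule greedy_plucker[where \<omega> = "mweight a"]) blast+
  \<comment> \<open>Taking \<open>\<phi>\<close> to be the weight of the type, the dominated
    rearrangement keeps the positive total.\<close>
  have stab':
    "\<exists>k1\<in>quad_monos. \<exists>k2\<in>quad_monos. \<exists>k3\<in>quad_monos. p k1 k2 k3 \<noteq> 0 \<and>
      mweight a k1 \<le> mweight a b1 \<and> mweight a k2 \<le> mweight a b2
        \<and> mweight a k3 \<le> mweight a b3 \<and>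
      0 < mweight ((!) \<rho>) k1 + mweight ((!) \<rho>) k2 + mweight ((!) \<rho>) k3"
    if "stable_type Q1 Q2 Q3 \<rho>" for \<rho>
    using stab[OF that] dominated by metis
  have "mweight a b1 + mweight a b2 + mweight a b3 \<le> 0"
    using unstable b unfolding stable_wrt_def p_def by (meson not_le)
  with a le have "mweight a b3 < a 0 + a 4"
  proof (rule weight_cover)
    fix \<rho> v1 v2 v3
    assume "(\<rho>, v1, v2, v3) \<in> critical_bounds"
    then have "stable_type Q1 Q2 Q3 \<rho>" and v: "v1 + v2 + v3 \<le> 0"
      using assms(2) by (auto simp: critical_bounds_def)
    from stab'[OF this(1)] obtain k1 k2 k3 where
      k: "k1 \<in> quad_monos" "k2 \<in> quad_monos" "k3 \<in> quad_monos"
      "mweight a k1 \<le> mweight a b1" "mweight a k2 \<le> mweight a b2"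
        "mweight a k3 \<le> mweight a b3"
      and pos: "0 < mweight ((!) \<rho>) k1 + mweight ((!) \<rho>) k2 + mweight ((!) \<rho>) k3"
        by blast
    \<comment> \<open>A positive total cannot obey three bounds whose sum is at most 0, so some
      \<open>k\<close> violates its own bound.\<close>
    have "v1 < mweight ((!) \<rho>) k1 \<or> v2 < mweight ((!) \<rho>) k2
      \<or> v3 < mweight ((!) \<rho>) k3"
      using v pos by linarith
    then show "\<exists>m\<in>quad_monos. mweight a m \<le> mweight a b1
      \<and> v1 < mweight ((!) \<rho>) m
        \<or> mweight a m \<le> mweight a b2 \<and> v2 < mweight ((!) \<rho>) m
        \<or> mweight a m \<le> mweight a b3 \<and> v3 < mweight ((!) \<rho>) m"
      using k by blast
  qed
  moreover have "a 1 \<le> a 0" "a 2 \<le> a 1" "a 3 \<le> a 2" "a 4 \<le> a 3" "a 5 \<le> a 4"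
    using a by (auto simp: numtype_def numeral_eq_Suc)
  \<comment> \<open>Each x0 xj with j at most 4 has a-weight at least \<open>a 0 + a 4\<close>,
    which is too heavy.\<close>
  ultimately have small: "m = (0, 5) \<or> mweight ((!) [5,-1,-1,-1,-1,-1]) m = -2"
    if "m \<in> quad_monos" "mweight a m \<le> mweight a b3" for m
    using that unfolding quad_monos_eq mweight_def by (elim insertE emptyE) simp_all
  from stab'[OF \<open>stable_type Q1 Q2 Q3 [5,-1,-1,-1,-1,-1]\<close>] obtain k1 k2 k3 where
    k: "k1 \<in> quad_monos" "k2 \<in> quad_monos" "k3 \<in> quad_monos" "p k1 k2 k3 \<noteq> 0"
    "mweight a k1 \<le> mweight a b1" "mweight a k2 \<le> mweight a b2"
      "mweight a k3 \<le> mweight a b3"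
    and pos: "0 < mweight ((!) [5,-1,-1,-1,-1,-1]) k1 + mweight ((!) [5,-1,-1,-1,-1,-1]) k2
      + mweight ((!) [5,-1,-1,-1,-1,-1]) k3" by blast
  \<comment> \<open>At most one \<open>k\<close> is x0 x5, so the total is at most 4 - 2 - 2 = 0,
    against \<open>pos\<close>.\<close>
  have "k1 \<noteq> k2" "k2 \<noteq> k3" "k1 \<noteq> k3"
    using k(4) unfolding p_def by (rule plucker_distinct)+
  moreover have "mweight ((!) [5,-1,-1,-1,-1,-1]) (0, 5) = 4" by (simp add: mweight_def)
  ultimately show False
    using small[of k1] small[of k2] small[of k3] k le pos by auto
qed

end
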